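(* Let $(G_1,\oplus_1,\otimes_1,\phi_1)$ and $(G_2,\oplus_2,\otimes_2,\phi_2)$ be generalized gyrovector spaces, with gyrometrics $\varrho_1$ and $\varrho_2$ respectively. Suppose that $T\colon G_1\to G_2$ is a surjection satisfying $\varrho_2(T\boldsymbol{a},T\boldsymbol{b})=\varrho_1(\boldsymbol{a},\boldsymbol{b})$ for every pair $\boldsymbol{a},\boldsymbol{b}\in G_1$. Then $T$ preserves gyromidpoints: $\boldsymbol{P}(T\boldsymbol{a},T\boldsymbol{b})=T(\boldsymbol{P}(\boldsymbol{a},\boldsymbol{b}))$ for every pair $\boldsymbol{a},\boldsymbol{b}\in G_1$, where $\boldsymbol{P}$ denotes the gyromidpoint in $G_2$ on the left-hand side and in $G_1$ on the right-hand side.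
   Context: Gyrogroups. A gyrogroup $(G,\oplus)$ is a nonempty set with a binary operation $\oplus$ such that: there is $\boldsymbol{e}\in G$ (the unit) with $\boldsymbol{e}\oplus\boldsymbol{a}=\boldsymbol{a}$ for all $\boldsymbol{a}$; each $\boldsymbol{a}$ has an element $\ominus\boldsymbol{a}$ with $\ominus\boldsymbol{a}\oplus\boldsymbol{a}=\boldsymbol{e}$; for all $\boldsymbol{a},\boldsymbol{b}$ there is a map $\operatorname{gyr}[\boldsymbol{a},\boldsymbol{b}]\colon G\to G$, which is an automorphism of $(G,\oplus)$, such that $\boldsymbol{a}\oplus(\boldsymbol{b}\oplus\boldsymbol{c})=(\boldsymbol{a}\oplus\boldsymbol{b})\oplus\operatorname{gyr}[\boldsymbol{a},\boldsymbol{b}]\boldsymbol{c}$ for all $\boldsymbol{c}$ (and $\operatorname{gyr}[\boldsymbol a,\boldsymbol b]\boldsymbol c$ is the unique element with this property); and $\operatorname{gyr}[\boldsymbol{a}\oplus\boldsymbol{b},\boldsymbol{b}]=\operatorname{gyr}[\boldsymbol{a},\boldsymbol{b}]$. It is gyrocommutative if $\boldsymbol{a}\oplus\boldsymbol{b}=\operatorname{gyr}[\boldsymbol{a},\boldsymbol{b}](\boldsymbol{b}\oplus\boldsymbol{a})$ for all $\boldsymbol{a},\boldsymbol{b}$. Write $\boldsymbol{a}\ominus\boldsymbol{b}=\boldsymbol{a}\oplus(\ominus\boldsymbol{b})$. The gyrogroup coaddition is $\boldsymbol{a}\boxplus\boldsymbol{b}=\boldsymbol{a}\oplus\operatorname{gyr}[\boldsymbol{a},\ominus\boldsymbol{b}]\boldsymbol{b}$.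 Generalized gyrovector space (GGV). Let $(G,\oplus)$ be a gyrocommutative gyrogroup with unit $\boldsymbol{e}$, with a map $\otimes\colon\mathbb{R}\times G\to G$, and let $\phi$ be an injection from $G$ into a real normed space $(\mathbb{V},\|\cdot\|)$. Then $(G,\oplus,\otimes,\phi)$ (also written $(G,\oplus,\otimes)$) is a GGV if: (GGV0) $\|\phi(\operatorname{gyr}[\boldsymbol{u},\boldsymbol{v}]\boldsymbol{a})\|=\|\phi(\boldsymbol{a})\|$ for all $\boldsymbol{u},\boldsymbol{v},\boldsymbol{a}\in G$; (GGV1) $1\otimes\boldsymbol{a}=\boldsymbol{a}$ for all $\boldsymbol{a}\in G$; (GGV2) $(r_1+r_2)\otimes\boldsymbol{a}=(r_1\otimes\boldsymbol{a})\oplus(r_2\otimes\boldsymbol{a})$ for all $\boldsymbol{a}\in G$, $r_1,r_2\in\mathbb{R}$; (GGV3) $(r_1r_2)\otimes\boldsymbol{a}=r_1\otimes(r_2\otimes\boldsymbol{a})$ for all $\boldsymbol{a}\in G$, $r_1,r_2\in\mathbb{R}$; (GGV4) $\phi(|r|\otimes\boldsymbol{a})/\|\phi(r\otimes\boldsymbol{a})\|=\phi(\boldsymbol{a})/\|\phi(\boldsymbol{a})\|$ for all $\boldsymbol{a}\in G\setminus\{\boldsymbol{e}\}$, $r\in\mathbb{R}\setminus\{0\}$ (the denominators are automatically nonzero given the other conditions); (GGV5) $\operatorname{gyr}[\boldsymbol{u},\boldsymbol{v}](r\otimes\boldsymbol{a})=r\otimes\operatorname{gyr}[\boldsymbol{u},\boldsymbol{v}]\boldsymbol{a}$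 for all $\boldsymbol{u},\boldsymbol{v},\boldsymbol{a}\in G$, $r\in\mathbb{R}$; (GGV6) $\operatorname{gyr}[r_1\otimes\boldsymbol{v},r_2\otimes\boldsymbol{v}]=\mathrm{id}_G$ for all $\boldsymbol{v}\in G$, $r_1,r_2\in\mathbb{R}$; (GGVV) the set $\|\phi(G)\|=\{\pm\|\phi(\boldsymbol{a})\|\in\mathbb{R}:\boldsymbol{a}\in G\}$ is a real linear space of dimension one with some vector addition $\oplus'$ and scalar multiplication $\otimes'$ (part of the data, not necessarily the usual operations of $\mathbb{R}$); (GGV7) $\|\phi(r\otimes\boldsymbol{a})\|=|r|\otimes'\|\phi(\boldsymbol{a})\|$ for all $\boldsymbol{a}\in G$, $r\in\mathbb{R}$; (GGV8) $\|\phi(\boldsymbol{a}\oplus\boldsymbol{b})\|\le\|\phi(\boldsymbol{a})\|\oplus'\|\phi(\boldsymbol{b})\|$ for all $\boldsymbol{a},\boldsymbol{b}\in G$, where $\le$ is the usual order of $\mathbb{R}$. The gyrometric of a GGV is $\varrho(\boldsymbol{a},\boldsymbol{b})=\|\phi(\boldsymbol{a}\ominus\boldsymbol{b})\|$. The gyromidpoint of $\boldsymbol{a},\boldsymbol{b}\in G$ is $\boldsymbol{P}(\boldsymbol{a},\boldsymbol{b})=\frac12\otimes(\boldsymbol{a}\boxplus\boldsymbol{b})$. *)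

theory Defs
  imports Complex_Main
begin

text \<open>The underlying set of a gyrogroup is a whole type. The unit, the inverse and the gyrations
  are parameters of the locale; they are uniquely determined by the operation.\<close>

locale gyrogroup =
  fixes add :: "'g \<Rightarrow> 'g \<Rightarrow> 'g" (infixl \<open>\<oplus>\<close> 65)
    and unit :: 'g (\<open>\<e>\<close>)
    and neg :: "'g \<Rightarrow> 'g" (\<open>\<ominus> _\<close> [81] 80)
    and gyr :: "'g \<Rightarrow> 'g \<Rightarrow> 'g \<Rightarrow> 'g"
  assumes left_unit: "\<e> \<oplus> a = a"
    and left_inverse: "\<ominus> a \<oplus> a = \<e>"
    and gyr_bij: "bij (gyr a b)"
    and gyr_hom: "gyr a b (c \<oplus> d) = gyr a b c \<oplus> gyr a b d"
    and gyr_assoc: "a \<oplus> (b \<oplus> c) = (a \<oplus> b) \<oplus> gyr a b c"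
    and gyr_unique: "a \<oplus> (b \<oplus> c) = (a \<oplus> b) \<oplus> d \<Longrightarrow> d = gyr a b c"
    and left_loop: "gyr (a \<oplus> b) b = gyr a b"

locale gyrocommutative_gyrogroup = gyrogroup +
  assumes gyrocomm: "a \<oplus> b = gyr a b (b \<oplus> a)"

definition coadd ::
  "('g \<Rightarrow> 'g \<Rightarrow> 'g) \<Rightarrow> ('g \<Rightarrow> 'g) \<Rightarrow> ('g \<Rightarrow> 'g \<Rightarrow> 'g \<Rightarrow> 'g) \<Rightarrow> 'g \<Rightarrow> 'g \<Rightarrow> 'g"
  where "coadd add neg gyr a b = add a (gyr a (neg b) b)"

text \<open>A real linear space on a set \<open>S\<close> whose operations need not be those of the ambient type;
  outside \<open>S\<close> the operations are arbitrary.\<close>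

locale real_linear_space_on =
  fixes S :: "'a set"
    and vadd :: "'a \<Rightarrow> 'a \<Rightarrow> 'a"
    and vzero :: 'a
    and vscale :: "real \<Rightarrow> 'a \<Rightarrow> 'a"
  assumes vadd_closed: "x \<in> S \<Longrightarrow> y \<in> S \<Longrightarrow> vadd x y \<in> S"
    and vzero_closed: "vzero \<in> S"
    and vscale_closed: "x \<in> S \<Longrightarrow> vscale r x \<in> S"
    and vadd_assoc:
      "x \<in> S \<Longrightarrow> y \<in> S \<Longrightarrow> z \<in> S \<Longrightarrow> vadd (vadd x y) z = vadd x (vadd y z)"
    and vadd_commute: "x \<in> S \<Longrightarrow> y \<in> S \<Longrightarrow> vadd x y = vadd y x"
    and vadd_vzero: "x \<in> S \<Longrightarrow> vadd x vzero = x"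
    and vadd_inverse: "x \<in> S \<Longrightarrow> \<exists>y\<in>S. vadd x y = vzero"
    and vscale_right_distrib:
      "x \<in> S \<Longrightarrow> y \<in> S \<Longrightarrow> vscale r (vadd x y) = vadd (vscale r x) (vscale r y)"
    and vscale_left_distrib: "x \<in> S \<Longrightarrow> vscale (r + s) x = vadd (vscale r x) (vscale s x)"
    and vscale_vscale: "x \<in> S \<Longrightarrow> vscale (r * s) x = vscale r (vscale s x)"
    and vscale_one: "x \<in> S \<Longrightarrow> vscale 1 x = x"

text \<open>Dimension one: some singleton \<open>{v}\<close> is a basis, that is, linearly independent and
  spanning.\<close>

definition one_dim_real_linear_space_on ::
  "'a set \<Rightarrow> ('a \<Rightarrow> 'a \<Rightarrow> 'a) \<Rightarrow> (real \<Rightarrow> 'a \<Rightarrow> 'a) \<Rightarrow> bool"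
  where "one_dim_real_linear_space_on S vadd vscale \<longleftrightarrow>
    (\<exists>vzero. real_linear_space_on S vadd vzero vscale \<and>
      (\<exists>v\<in>S. (\<forall>r. vscale r v = vzero \<longrightarrow> r = 0) \<and> (\<forall>x\<in>S. \<exists>r. x = vscale r v)))"

definition norm_set :: "('g \<Rightarrow> 'v::real_normed_vector) \<Rightarrow> real set"
  where "norm_set \<phi> = {x. \<exists>a. x = norm (\<phi> a) \<or> x = - norm (\<phi> a)}"

text \<open>In \<open>GGV4\<close>, division by zero does not occur: injectivity of \<open>\<phi>\<close> and the axioms other than
  \<open>GGV4\<close> imply that \<open>\<phi> a \<noteq> 0\<close> for \<open>a \<noteq> \<e>\<close>, and that \<open>r \<otimes> a \<noteq> \<e>\<close> for \<open>a \<noteq> \<e>\<close> and \<open>r \<noteq> 0\<close>.\<close>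

locale generalized_gyrovector_space =
  gyrocommutative_gyrogroup add unit neg gyr
  for add :: "'g \<Rightarrow> 'g \<Rightarrow> 'g" (infixl \<open>\<oplus>\<close> 65)
    and unit :: 'g (\<open>\<e>\<close>)
    and neg :: "'g \<Rightarrow> 'g" (\<open>\<ominus> _\<close> [81] 80)
    and gyr :: "'g \<Rightarrow> 'g \<Rightarrow> 'g \<Rightarrow> 'g" +
  fixes scale :: "real \<Rightarrow> 'g \<Rightarrow> 'g" (infixr \<open>\<otimes>\<close> 75)
    and \<phi> :: "'g \<Rightarrow> 'v::real_normed_vector"
    and vadd :: "real \<Rightarrow> real \<Rightarrow> real" (infixl \<open>\<oplus>''\<close> 65)
    and vscale :: "real \<Rightarrow> real \<Rightarrow> real" (infixr \<open>\<otimes>''\<close> 75)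
  assumes phi_inj: "inj \<phi>"
    and GGV0: "norm (\<phi> (gyr u v a)) = norm (\<phi> a)"
    and GGV1: "1 \<otimes> a = a"
    and GGV2: "(r1 + r2) \<otimes> a = (r1 \<otimes> a) \<oplus> (r2 \<otimes> a)"
    and GGV3: "(r1 * r2) \<otimes> a = r1 \<otimes> (r2 \<otimes> a)"
    and GGV4: "a \<noteq> \<e> \<Longrightarrow> r \<noteq> 0 \<Longrightarrow>
      \<phi> (\<bar>r\<bar> \<otimes> a) /\<^sub>R norm (\<phi> (r \<otimes> a)) = \<phi> a /\<^sub>R norm (\<phi> a)"
    and GGV5: "gyr u v (r \<otimes> a) = r \<otimes> gyr u v a"
    and GGV6: "gyr (r1 \<otimes> v) (r2 \<otimes> v) = id"
    and GGVV: "one_dim_real_linear_space_on (norm_set \<phi>) (\<oplus>') (\<otimes>')"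
    and GGV7: "norm (\<phi> (r \<otimes> a)) = \<bar>r\<bar> \<otimes>' norm (\<phi> a)"
    and GGV8: "norm (\<phi> (a \<oplus> b)) \<le> norm (\<phi> a) \<oplus>' norm (\<phi> b)"

definition gyrometric ::
  "('g \<Rightarrow> 'g \<Rightarrow> 'g) \<Rightarrow> ('g \<Rightarrow> 'g) \<Rightarrow> ('g \<Rightarrow> 'v::real_normed_vector) \<Rightarrow> 'g \<Rightarrow> 'g \<Rightarrow> real"
  where "gyrometric add neg \<phi> a b = norm (\<phi> (add a (neg b)))"

definition gyromidpoint ::
  "('g \<Rightarrow> 'g \<Rightarrow> 'g) \<Rightarrow> ('g \<Rightarrow> 'g) \<Rightarrow> ('g \<Rightarrow> 'g \<Rightarrow> 'g \<Rightarrow> 'g) \<Rightarrow> (real \<Rightarrow> 'g \<Rightarrow> 'g) \<Rightarrow>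
    'g \<Rightarrow> 'g \<Rightarrow> 'g"
  where "gyromidpoint add neg gyr scale a b = scale (1 / 2) (coadd add neg gyr a b)"

end

theory Submission
  imports Defs
begin

text \<open>Vaisala's proof of the Mazur--Ulam theorem carries over. The point reflection
  \<open>x \<mapsto> p \<oplus> \<ominus> (\<ominus> p \<oplus> x)\<close> is an isometric involution that moves each point by twice its
  distance to \<open>p\<close>, and the reflection in the gyromidpoint of \<open>a\<close> and \<open>b\<close> swaps \<open>a\<close> and \<open>b\<close>.
  This forces every bijective isometry that fixes \<open>a\<close> and \<open>b\<close> to fix their gyromidpoint.
  Apply it to the composition of \<open>T\<close>, the reflection in the gyromidpoint of \<open>T a\<close> and \<open>T b\<close>, the
  inverse of \<open>T\<close>, and the reflection in the gyromidpoint of \<open>a\<close> and \<open>b\<close>. The two gyrometrics are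
  made into genuine metrics by coordinates on the two one-dimensional spaces; these may differ,
  but \<open>T\<close> preserves equality of distances, which is all that is needed.\<close>

section \<open>Gyrogroup identities and point reflections\<close>

context gyrogroup
begin

lemma gyr_unit_left: "gyr \<e> a = id"
  using gyr_unique[of \<e> a] by (auto simp: left_unit)

lemma left_cancel: "\<ominus> a \<oplus> (a \<oplus> b) = b"
  using gyr_assoc[of "\<ominus> a" a b] left_loop[of "\<ominus> a" a]
  by (simp add: left_inverse left_unit gyr_unit_left)

lemma add_left_eq_iff: "a \<oplus> b = a \<oplus> c \<longleftrightarrow> b = c"
  by (metis left_cancel)

lemma right_unit: "a \<oplus> \<e> = a"
  by (metis add_left_eq_iff left_cancel left_inverse)

lemma right_inverse: "a \<oplus> \<ominus> a = \<e>"
  by (metis left_cancel left_inverse right_unit)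

lemma neg_neg: "\<ominus> (\<ominus> a) = a"
  by (metis add_left_eq_iff left_inverse right_inverse)

lemma neg_unit: "\<ominus> \<e> = \<e>"
  by (metis left_unit right_inverse)

lemma left_cancel': "a \<oplus> (\<ominus> a \<oplus> b) = b"
  by (metis left_cancel neg_neg)

lemma neg_unique: "a \<oplus> b = \<e> \<Longrightarrow> \<ominus> a = b"
  by (metis left_cancel right_unit)

lemma gyr_e: "gyr a b \<e> = \<e>"
  by (metis add_left_eq_iff gyr_hom right_unit)

lemma gyr_neg: "gyr a b (\<ominus> c) = \<ominus> gyr a b c"
  by (metis gyr_e gyr_hom neg_unique right_inverse)

lemma gyr_eq_iff: "gyr a b c = gyr a b d \<longleftrightarrow> c = d"
  by (meson bij_is_inj gyr_bij injD)

lemma gyrotranslation: "\<ominus> (x \<oplus> a) \<oplus> (x \<oplus> b) = gyr x a (\<ominus> a \<oplus> b)"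
  by (metis gyr_assoc left_cancel left_cancel')

lemma neg_add: "\<ominus> (a \<oplus> b) = gyr a b (\<ominus> b \<oplus> \<ominus> a)"
  by (rule neg_unique) (simp add: gyr_assoc[symmetric] left_cancel' right_inverse)

lemma gyr_inverse: "gyr (\<ominus> a) (a \<oplus> b) (gyr a b c) = c"
  by (metis add_left_eq_iff gyr_assoc left_cancel)

lemma gyr_add_inverse: "gyr b (a \<oplus> b) (gyr a b c) = c"
  using gyr_inverse[of a b c] left_loop[of "\<ominus> a" "a \<oplus> b"] by (simp add: left_cancel)

text \<open>Adding \<open>\<ominus> gyr a b b\<close> to \<open>a \<oplus> b\<close> returns
  \<open>a\<close>, so the left loop property trades \<open>a \<oplus> b\<close> for
  \<open>a\<close> in the outer gyration.\<close>

lemma gyr_nested: "gyr a (\<ominus> gyr a b b) (gyr a b c) = c"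
proof -
  have 1: "(a \<oplus> b) \<oplus> \<ominus> gyr a b b = a"
    by (metis gyr_assoc gyr_neg right_inverse right_unit)
  have "(a \<oplus> b) \<oplus> (\<ominus> gyr a b b \<oplus> gyr a b c) = a \<oplus> c"
    by (metis gyr_assoc gyr_hom gyr_neg left_cancel')
  then have "a \<oplus> c = a \<oplus> gyr (a \<oplus> b) (\<ominus> gyr a b b) (gyr a b c)"
    by (simp add: gyr_assoc 1)
  moreover have "gyr (a \<oplus> b) (\<ominus> gyr a b b) = gyr a (\<ominus> gyr a b b)"
    using left_loop[of "a \<oplus> b" "\<ominus> gyr a b b"] by (simp add: 1)
  ultimately show ?thesis
    by (simp add: add_left_eq_iff)
qed

lemma right_division: "(b \<oplus> \<ominus> gyr b a a) \<oplus> a = b"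
proof -
  have "(b \<oplus> \<ominus> gyr b a a) \<oplus> gyr b (\<ominus> gyr b a a) (gyr b a a) = b"
    by (simp add: gyr_assoc[symmetric] left_inverse right_unit)
  then show ?thesis
    by (simp add: gyr_nested)
qed

text \<open>For \<open>x \<oplus> b = a\<close>, solvable by \<open>right_division\<close>, the left
  loop property gives \<open>gyr a b = gyr x b\<close>, which \<open>gyr b (x \<oplus> b)\<close>
  inverts.\<close>

lemma gyr_swap: "gyr b a (gyr a b c) = c"
  by (metis gyr_add_inverse left_loop right_division)

lemma gyr_neg_inverse: "gyr (\<ominus> b) (\<ominus> a) (gyr a b c) = c"
proof -
  let ?d = "gyr (\<ominus> b) (\<ominus> a) (gyr a b c)"
  \<comment> \<open>One sum, evaluated from the inside by reassociating and from the outside by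
    \<open>neg_add\<close>.\<close>
  have "a \<oplus> (b \<oplus> ((\<ominus> b \<oplus> \<ominus> a) \<oplus> ?d)) = gyr a b c"
    by (simp add: gyr_assoc[symmetric] left_cancel')
  moreover have "a \<oplus> (b \<oplus> ((\<ominus> b \<oplus> \<ominus> a) \<oplus> ?d)) = gyr a b ?d"
    by (metis gyr_assoc gyr_hom left_cancel' neg_add)
  ultimately show ?thesis
    by (simp add: gyr_eq_iff)
qed

definition reflect :: "'g \<Rightarrow> 'g \<Rightarrow> 'g"
  where "reflect p x = p \<oplus> \<ominus> (\<ominus> p \<oplus> x)"

lemma reflect_reflect: "reflect p (reflect p x) = x"
  by (simp add: reflect_def left_cancel left_cancel' neg_neg)

lemma reflect_self: "reflect p p = p"
  by (simp add: reflect_def left_inverse neg_unit right_unit)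

lemma bij_reflect: "bij (reflect p)"
  by (rule involuntory_imp_bij) (rule reflect_reflect)

end

section \<open>Consequences of gyrocommutativity\<close>

context gyrocommutative_gyrogroup
begin

text \<open>Both sides invert \<open>gyr b a\<close>.\<close>

lemma gyr_even: "gyr (\<ominus> a) (\<ominus> b) = gyr a b"
  by (rule ext) (metis gyr_neg_inverse gyr_swap)

text \<open>By evenness the gyration in \<open>neg_add\<close> is
  \<open>gyr (\<ominus> a) (\<ominus> b)\<close>, which gyrocommutativity absorbs.\<close>

lemma automorphic_inverse: "\<ominus> (a \<oplus> b) = \<ominus> a \<oplus> \<ominus> b"
  by (metis gyr_even gyrocomm neg_add)

lemma reflect_conv_double:
  assumes "gyr p p = id"
  shows "reflect p x = (p \<oplus> p) \<oplus> \<ominus> x"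
  by (simp add: reflect_def automorphic_inverse neg_neg gyr_assoc assms)

end

section \<open>Metric and isometries of a real-valued gyronorm\<close>

locale gyronormed_gyrogroup = gyrocommutative_gyrogroup add unit neg gyr
  for add :: "'g \<Rightarrow> 'g \<Rightarrow> 'g" (infixl \<open>\<oplus>\<close> 65)
    and unit :: 'g (\<open>\<e>\<close>)
    and neg :: "'g \<Rightarrow> 'g" (\<open>\<ominus> _\<close> [81] 80)
    and gyr :: "'g \<Rightarrow> 'g \<Rightarrow> 'g \<Rightarrow> 'g" +
  fixes N :: "'g \<Rightarrow> real"
  assumes N_eq_0: "N a = 0 \<longleftrightarrow> a = \<e>"
    and N_gyr: "N (gyr u v a) = N a"
    and N_neg: "N (\<ominus> a) = N a"
    and N_double: "N (a \<oplus> a) = 2 * N a"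
    and N_triangle: "N (a \<oplus> b) \<le> N a + N b"
begin

text \<open>Negating the left argument makes left translations isometric, by
  \<open>gyrotranslation\<close>. By \<open>gdist_neg\<close> the value is also
  \<open>N (a \<oplus> \<ominus> b)\<close>, the form of the gyrometric.\<close>

definition gdist :: "'g \<Rightarrow> 'g \<Rightarrow> real"
  where "gdist a b = N (\<ominus> a \<oplus> b)"

lemma gdist_translate: "gdist (x \<oplus> a) (x \<oplus> b) = gdist a b"
  by (simp add: gdist_def gyrotranslation N_gyr)

lemma gdist_neg: "gdist (\<ominus> a) (\<ominus> b) = gdist a b"
  by (metis gdist_def automorphic_inverse N_neg)

lemma gdist_commute: "gdist a b = gdist b a"
  by (metis gdist_def N_gyr N_neg neg_add neg_neg)

lemma gdist_eq_0: "gdist a b = 0 \<longleftrightarrow> a = b"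
  by (metis gdist_def N_eq_0 left_cancel' left_inverse right_unit)

lemma gdist_nonneg: "0 \<le> gdist a b"
proof -
  have "0 \<le> N x" for x
    using N_triangle[of x "\<ominus> x"] N_eq_0[of \<e>] by (simp add: right_inverse N_neg)
  then show ?thesis
    by (simp add: gdist_def)
qed

lemma gdist_triangle: "gdist a c \<le> gdist a b + gdist b c"
proof -
  have "gdist a c = gdist (\<ominus> b \<oplus> a) (\<ominus> b \<oplus> c)"
    by (simp add: gdist_translate)
  also have "\<dots> \<le> gdist b a + gdist b c"
    unfolding gdist_def using N_triangle N_neg by metis
  finally show ?thesis
    by (simp add: gdist_commute)
qed

lemma gdist_reflect: "gdist (reflect p x) (reflect p y) = gdist x y"
  by (simp add: reflect_def gdist_translate gdist_neg)

lemma gdist_reflect_self: "gdist (reflect p x) x = 2 * gdist p x"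
proof -
  have "gdist (reflect p x) x = gdist (\<ominus> (\<ominus> p \<oplus> x)) (\<ominus> p \<oplus> x)"
    by (metis gdist_translate left_cancel' reflect_def)
  also have "\<dots> = 2 * gdist p x"
    by (simp add: gdist_def neg_neg N_double)
  finally show ?thesis .
qed

text \<open>Each such \<open>g\<close> yields another one, \<open>reflect p \<circ> inv g \<circ> reflect p \<circ> g\<close>, that moves \<open>p\<close>
  twice as far; but no such \<open>g\<close> moves \<open>p\<close> farther than \<open>2 * gdist a p\<close>.\<close>

lemma isometry_displacement_bound:
  assumes "bij g" and "\<And>x y. gdist (g x) (g y) = gdist x y"
    and "g a = a" and "g b = b" and "reflect p a = b"
  shows "2 ^ n * gdist (g p) p \<le> 2 * gdist a p"
  using assms
proof (induction n arbitrary: g)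
  case 0
  then show ?case
    using gdist_triangle[of "g p" p a] by (metis gdist_commute mult_2 mult_1 power_0)
next
  case (Suc n)
  define h where "h = reflect p \<circ> inv g \<circ> reflect p \<circ> g"
  have g_inv: "g (inv g x) = x" for x
    using Suc.prems(1) by (simp add: bij_is_surj surj_f_inv_f)
  have inv_fix: "inv g a = a" "inv g b = b"
    using Suc.prems by (metis bij_inv_eq_iff)+
  have inv_iso: "gdist (inv g x) (inv g y) = gdist x y" for x y
    by (metis Suc.prems(2) g_inv)
  have b: "reflect p b = a"
    using Suc.prems(5) reflect_reflect by metis
  \<comment> \<open>\<open>h\<close> again fixes \<open>a\<close> and \<open>b\<close>: its two
    reflections swap them, while \<open>g\<close> and \<open>inv g\<close> fix both.\<close>
  have "2 ^ n * gdist (h p) p \<le> 2 * gdist a p"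
  proof (rule Suc.IH)
    show "bij h"
      unfolding h_def by (intro bij_comp bij_reflect bij_imp_bij_inv Suc.prems(1))
  qed (use Suc.prems b in \<open>simp_all add: h_def gdist_reflect inv_iso inv_fix\<close>)
  moreover have "gdist (h p) p = 2 * gdist (g p) p"
  proof -
    \<comment> \<open>The outer reflection is isometric and fixes \<open>p\<close>, so it drops out;
      applying \<open>g\<close> then removes \<open>inv g\<close>.\<close>
    have "gdist (h p) p = gdist (inv g (reflect p (g p))) p"
      by (metis comp_apply gdist_reflect h_def reflect_self)
    also have "\<dots> = gdist (reflect p (g p)) (g p)"
      by (metis Suc.prems(2) g_inv)
    also have "\<dots> = 2 * gdist (g p) p"
      by (metis gdist_reflect_self gdist_commute)
    finally show ?thesis .
  qed
  ultimately show ?case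
    by simp
qed

lemma isometry_fixes_centre:
  assumes "bij g" and "\<And>x y. gdist (g x) (g y) = gdist x y"
    and "g a = a" and "g b = b" and "reflect p a = b"
  shows "g p = p"
proof (rule ccontr)
  assume "g p \<noteq> p"
  then have pos: "0 < gdist (g p) p"
    using gdist_nonneg[of "g p" p] gdist_eq_0[of "g p" p] by linarith
  obtain n where "2 * gdist a p / gdist (g p) p < 2 ^ n"
    using real_arch_pow[of 2] by auto
  then have "2 * gdist a p < 2 ^ n * gdist (g p) p"
    using pos by (simp add: pos_divide_less_eq)
  with isometry_displacement_bound[OF assms, of n] show False
    by simp
qed

end

section \<open>Gyromidpoints and gyronorm of a generalized gyrovector space\<close>

context generalized_gyrovector_space
begin

lemma scale_zero: "0 \<otimes> a = \<e>"
  using GGV2[of 0 0 a] by (metis add_0 left_cancel left_inverse)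

lemma scale_minus_one: "(-1) \<otimes> a = \<ominus> a"
  using GGV2[of 1 "-1" a] by (simp add: scale_zero GGV1 neg_unique)

lemma scale_two: "2 \<otimes> a = a \<oplus> a"
  using GGV2[of 1 1 a] by (simp add: GGV1)

lemma gyr_self: "gyr a a = id"
  using GGV6[of 1 a 1] by (simp add: GGV1)

text \<open>The point \<open>q\<close> halfway along the gyroline from \<open>a\<close> to
  \<open>b\<close> has the reflection property directly; the coaddition is then recognized as
  \<open>2 \<otimes> q\<close>.\<close>

lemma reflect_gyromidpoint: "reflect (gyromidpoint (\<oplus>) neg gyr (\<otimes>) a b) a = b"
proof -
  define h where "h = (1/2) \<otimes> (\<ominus> a \<oplus> b)"
  define q where "q = a \<oplus> h"
  have hh: "h \<oplus> h = \<ominus> a \<oplus> b"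
    unfolding h_def scale_two[symmetric] by (simp add: GGV3[symmetric] GGV1)
  have qa: "\<ominus> q \<oplus> a = gyr a h (\<ominus> h)"
    using gyrotranslation[of a h \<e>] by (simp add: q_def right_unit)
  have "\<ominus> q \<oplus> b = gyr a h (\<ominus> h \<oplus> (h \<oplus> h))"
    using gyrotranslation[of a h "h \<oplus> h"] by (simp add: q_def hh left_cancel')
  also have "\<dots> = \<ominus> (\<ominus> q \<oplus> a)"
    by (simp add: left_cancel qa gyr_neg neg_neg)
  finally have refl: "reflect q a = b"
    by (metis reflect_def left_cancel')
  then have "reflect q b = a"
    using reflect_reflect by metis
  then have a: "(q \<oplus> q) \<oplus> \<ominus> b = a"
    by (simp add: reflect_conv_double gyr_self)
  \<comment> \<open>With \<open>a\<close> in this form the left loop property reduces the gyration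
    to \<open>gyr (q \<oplus> q) (\<ominus> b)\<close>, and associativity cancels
    \<open>b\<close>.\<close>
  have "coadd (\<oplus>) neg gyr a b = ((q \<oplus> q) \<oplus> \<ominus> b) \<oplus> gyr ((q \<oplus> q) \<oplus> \<ominus> b) (\<ominus> b) b"
    by (simp add: coadd_def a)
  also have "\<dots> = 2 \<otimes> q"
    by (simp add: left_loop gyr_assoc[symmetric] left_inverse right_unit scale_two)
  finally have "gyromidpoint (\<oplus>) neg gyr (\<otimes>) a b = q"
    by (simp add: gyromidpoint_def GGV3[symmetric] GGV1)
  with refl show ?thesis
    by simp
qed

text \<open>The coordinate of \<open>norm (\<phi> a)\<close> in the one-dimensional space has constant sign because
  \<open>norm_set \<phi>\<close> is symmetric about \<open>0\<close>; up to that sign it is the gyronorm. No compatibility of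
  \<open>\<le>\<close> with the operations \<open>\<oplus>'\<close> and \<open>\<otimes>'\<close> is assumed; it is a consequence of \<open>GGV8\<close> for two
  multiples of the same element.\<close>

lemma gyronorm_exists:
  "\<exists>N. gyronormed_gyrogroup (\<oplus>) \<e> neg gyr N \<and> (\<forall>a b. N a = N b \<longleftrightarrow> norm (\<phi> a) = norm (\<phi> b))"
proof -
  obtain z v where L: "real_linear_space_on (norm_set \<phi>) (\<oplus>') z (\<otimes>')"
    and v: "v \<in> norm_set \<phi>" and indep: "\<And>r. r \<otimes>' v = z \<Longrightarrow> r = 0"
    and span: "\<And>x. x \<in> norm_set \<phi> \<Longrightarrow> \<exists>r. x = r \<otimes>' v"
    using GGVV unfolding one_dim_real_linear_space_on_def by blast
  interpret L: real_linear_space_on "norm_set \<phi>" "(\<oplus>')" z "(\<otimes>')"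
    by (fact L)
  have norm_in: "norm (\<phi> a) \<in> norm_set \<phi>" for a
    by (auto simp: norm_set_def)
  have zero_v: "0 \<otimes>' v = z"
  proof -
    have "0 \<otimes>' v \<oplus>' 0 \<otimes>' v = 0 \<otimes>' v"
      using L.vscale_left_distrib[OF v, of 0 0] by simp
    moreover have in0: "0 \<otimes>' v \<in> norm_set \<phi>"
      by (rule L.vscale_closed[OF v])
    then obtain y where "y \<in> norm_set \<phi>" "0 \<otimes>' v \<oplus>' y = z"
      using L.vadd_inverse by blast
    ultimately show ?thesis
      by (metis L.vadd_assoc L.vadd_vzero in0)
  qed
  have inj: "r = s" if "r \<otimes>' v = s \<otimes>' v" for r s
  proof -
    have "(r + - s) \<otimes>' v = z"
      using that zero_v L.vscale_left_distrib[OF v, of r "- s"]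
        L.vscale_left_distrib[OF v, of s "- s"]
      by simp
    then show ?thesis
      using indep[of "r + - s"] by simp
  qed
  obtain c where c: "\<And>x. x \<in> norm_set \<phi> \<Longrightarrow> x = c x \<otimes>' v"
    using span by metis
  define M where "M a = c (norm (\<phi> a))" for a
  have M: "norm (\<phi> a) = M a \<otimes>' v" for a
    unfolding M_def by (rule c[OF norm_in])
  have M_eq: "norm (\<phi> a) = norm (\<phi> b) \<longleftrightarrow> M a = M b" for a b
    using inj[of "M a" "M b"] M[of a] M[of b] by auto
  have M_scale: "M (r \<otimes> a) = \<bar>r\<bar> * M a" for r a
    by (rule inj) (simp only: M[symmetric] GGV7 L.vscale_vscale[OF v])
  have M_unit: "M \<e> = 0"
    using M_scale[of 0 \<e>] by (simp add: scale_zero)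
  \<comment> \<open>Otherwise \<open>norm_set \<phi>\<close> has at most two elements, but the
    multiples of \<open>v\<close> by 0, 1 and 2 are distinct.\<close>
  have "\<not> (\<forall>a. M a = 0)"
  proof
    assume "\<forall>a. M a = 0"
    then have "norm_set \<phi> \<subseteq> {z, - z}"
      using M zero_v by (auto simp: norm_set_def)
    moreover have "1 \<otimes>' v \<in> norm_set \<phi>" "2 \<otimes>' v \<in> norm_set \<phi>"
      using L.vscale_closed[OF v] by auto
    ultimately have "1 \<otimes>' v \<in> {z, - z}" "2 \<otimes>' v \<in> {z, - z}"
      by blast+
    then show False
      using indep[of 1] indep[of 2] inj[of 1 2] by auto
  qed
  then obtain a0 where a0: "M a0 \<noteq> 0"
    by blast
  have same_sign: "0 \<le> M a * M b" for a b
  proof (rule ccontr)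
    assume neg: "\<not> 0 \<le> M a * M b"
    have "0 \<le> x" if x: "x \<in> norm_set \<phi>" for x
    proof -
      \<comment> \<open>\<open>M a\<close> and \<open>M b\<close> have opposite signs, so one of
        them suits \<open>c x\<close>; a nonnegative multiple then realizes \<open>x\<close> as a
        norm.\<close>
      have "\<exists>d. M d \<noteq> 0 \<and> 0 \<le> c x / M d"
        using neg by (metis linorder_le_cases mult_nonneg_nonneg mult_nonpos_nonpos
          zero_le_divide_iff mult_zero_left mult_zero_right)
      then obtain d where "M d \<noteq> 0" "0 \<le> c x / M d"
        by blast
      then have "M ((c x / M d) \<otimes> d) = c x"
        by (simp add: M_scale del: abs_divide)
      then have "x = norm (\<phi> ((c x / M d) \<otimes> d))"
        using c[OF x] M by metis
      then show ?thesis
        by (metis norm_ge_zero)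
    qed
    moreover have "- x \<in> norm_set \<phi>" if "x \<in> norm_set \<phi>" for x
      using that by (auto simp: norm_set_def)
    ultimately have "x = 0" if "x \<in> norm_set \<phi>" for x
      using that by (metis neg_0_le_iff_le order_antisym)
    then have "M a = M a0" for a
      using M_eq norm_in by metis
    then show False
      using a0 M_unit by metis
  qed
  define \<sigma> where "\<sigma> = sgn (M a0)"
  define N where "N a = \<sigma> * M a" for a
  have \<sigma>: "\<sigma> * \<sigma> = 1"
    using a0 by (simp add: \<sigma>_def sgn_if)
  have M_N: "M a = \<sigma> * N a" for a
    using \<sigma> by (simp add: N_def mult.assoc[symmetric])
  have N_nonneg: "0 \<le> N a" for a
    using same_sign[of a0 a] a0 by (auto simp: N_def \<sigma>_def sgn_if zero_le_mult_iff)
  have N_a0: "0 < N a0"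
    using a0 by (simp add: N_def \<sigma>_def sgn_if)
  have N_norm: "N a = N b \<longleftrightarrow> norm (\<phi> a) = norm (\<phi> b)" for a b
    using \<sigma> M_N M_eq N_def by metis
  have N_scale: "N (r \<otimes> a) = \<bar>r\<bar> * N a" for r a
    by (simp add: N_def M_scale)
  have norm_N: "norm (\<phi> a) = (\<sigma> * N a) \<otimes>' v" for a
    using M M_N by simp
  have norm_add: "norm (\<phi> (a \<oplus> b)) \<le> (\<sigma> * (N a + N b)) \<otimes>' v" for a b
    using GGV8[of a b] L.vscale_left_distrib[OF v, of "\<sigma> * N a" "\<sigma> * N b"]
    by (simp add: norm_N[of a] norm_N[of b] distrib_left)
  have mono: "(\<sigma> * u) \<otimes>' v \<le> (\<sigma> * w) \<otimes>' v" if "0 \<le> u" "u \<le> w" for u w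
  proof -
    \<comment> \<open>Chosen so that \<open>s + t\<close> is \<open>w / N a0\<close> and
      \<open>s - t\<close> is \<open>u / N a0\<close>: two summands of total gyronorm
      \<open>w\<close> have a gyrosum of gyronorm \<open>u\<close>.\<close>
    define s t where "s = (w + u) / 2 / N a0" and "t = (w - u) / 2 / N a0"
    have "N (s \<otimes> a0) + N ((- t) \<otimes> a0) = w" "N ((s + - t) \<otimes> a0) = u"
      using that N_a0 by (simp_all add: N_scale s_def t_def field_simps)
    then show ?thesis
      using norm_add[of "s \<otimes> a0" "(- t) \<otimes> a0"] norm_N[of "(s + - t) \<otimes> a0"] by (simp only: GGV2)
  qed
  have triangle: "N (a \<oplus> b) \<le> N a + N b" for a b
  proof (rule ccontr)
    assume "\<not> N (a \<oplus> b) \<le> N a + N b"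
    then have less: "N a + N b < N (a \<oplus> b)"
      by simp
    \<comment> \<open>\<open>mono\<close> and GGV8 give opposite inequalities, hence equal
      coordinates, against strictness.\<close>
    then have "(\<sigma> * (N a + N b)) \<otimes>' v \<le> (\<sigma> * N (a \<oplus> b)) \<otimes>' v"
      using N_nonneg[of a] N_nonneg[of b] by (intro mono) auto
    then have "(\<sigma> * (N a + N b)) \<otimes>' v = (\<sigma> * N (a \<oplus> b)) \<otimes>' v"
      using norm_add[of a b] norm_N[of "a \<oplus> b"] by simp
    then have "\<sigma> * (N a + N b) = \<sigma> * N (a \<oplus> b)"
      by (rule inj)
    then show False
      using less \<sigma> by auto
  qed
  have N_unit: "N \<e> = 0"
    by (simp add: N_def M_unit)
  have "a = \<e>" if "N a = 0" for a
  proof (rule ccontr)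
    assume a: "a \<noteq> \<e>"
    \<comment> \<open>\<open>N a = 0\<close> says that \<open>norm (\<phi> a)\<close> is
      \<open>z\<close>, not that it is the number 0. If it is nonzero, GGV4 with factor 2 and
      equality of norms yield \<open>2 \<otimes> a = a\<close>.\<close>
    have eq: "norm (\<phi> (2 \<otimes> a)) = norm (\<phi> a)" "norm (\<phi> a) = norm (\<phi> \<e>)"
      using that N_norm N_scale N_unit by (metis mult_zero_right)+
    show False
    proof (cases "norm (\<phi> a) = 0")
      case True
      with eq have "\<phi> a = \<phi> \<e>"
        by simp
      with a show False
        using phi_inj by (auto dest: injD)
    next
      case False
      then have "\<phi> (2 \<otimes> a) = \<phi> a"
        using GGV4[OF a, of 2] eq by simp
      then have "2 \<otimes> a = a"
        using phi_inj by (auto dest: injD)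
      with a show False
        by (metis scale_two left_cancel left_inverse)
    qed
  qed
  then have "gyronormed_gyrogroup (\<oplus>) \<e> neg gyr N"
  proof unfold_locales
    show "N (gyr x y a) = N a" for x y a
      using N_norm GGV0 by metis
    show "N (\<ominus> a) = N a" for a
      using N_scale[of "-1" a] by (simp add: scale_minus_one)
    show "N (a \<oplus> a) = 2 * N a" for a
      using N_scale[of 2 a] by (simp add: scale_two)
  qed (auto simp: N_unit triangle)
  then show ?thesis
    using N_norm by blast
qed

lemma gyrometric_gyronorm:
  obtains N where "gyronormed_gyrogroup (\<oplus>) \<e> neg gyr N"
    and "\<And>a b x y. gyronormed_gyrogroup.gdist (\<oplus>) neg N a b
      = gyronormed_gyrogroup.gdist (\<oplus>) neg N x y
      \<longleftrightarrow> gyrometric (\<oplus>) neg \<phi> a b = gyrometric (\<oplus>) neg \<phi> x y"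
proof -
  obtain N where N: "gyronormed_gyrogroup (\<oplus>) \<e> neg gyr N"
    and eq: "\<And>a b. N a = N b \<longleftrightarrow> norm (\<phi> a) = norm (\<phi> b)"
    using gyronorm_exists by blast
  interpret gyronormed_gyrogroup "(\<oplus>)" \<e> neg gyr N
    by (fact N)
  have "gdist a b = N (a \<oplus> \<ominus> b)" for a b
    by (metis gdist_def gdist_neg neg_neg)
  then show thesis
    using that[OF N] eq by (simp add: gyrometric_def)
qed

end

section \<open>Transfer of gyromidpoints along the isometry\<close>

theorem theorem4p4:
  fixes add1 :: "'g \<Rightarrow> 'g \<Rightarrow> 'g" and e1 :: 'g and neg1 :: "'g \<Rightarrow> 'g"
    and gyr1 :: "'g \<Rightarrow> 'g \<Rightarrow> 'g \<Rightarrow> 'g" and scale1 :: "real \<Rightarrow> 'g \<Rightarrow> 'g"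
    and \<phi>1 :: "'g \<Rightarrow> 'v::real_normed_vector"
    and vadd1 vscale1 :: "real \<Rightarrow> real \<Rightarrow> real"
    and add2 :: "'h \<Rightarrow> 'h \<Rightarrow> 'h" and e2 :: 'h and neg2 :: "'h \<Rightarrow> 'h"
    and gyr2 :: "'h \<Rightarrow> 'h \<Rightarrow> 'h \<Rightarrow> 'h" and scale2 :: "real \<Rightarrow> 'h \<Rightarrow> 'h"
    and \<phi>2 :: "'h \<Rightarrow> 'w::real_normed_vector"
    and vadd2 vscale2 :: "real \<Rightarrow> real \<Rightarrow> real"
    and T :: "'g \<Rightarrow> 'h"
  assumes "generalized_gyrovector_space add1 e1 neg1 gyr1 scale1 \<phi>1 vadd1 vscale1"
    and "generalized_gyrovector_space add2 e2 neg2 gyr2 scale2 \<phi>2 vadd2 vscale2"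
    and "surj T"
    and "\<And>a b. gyrometric add2 neg2 \<phi>2 (T a) (T b) = gyrometric add1 neg1 \<phi>1 a b"
  shows "\<forall>a b. gyromidpoint add2 neg2 gyr2 scale2 (T a) (T b)
    = T (gyromidpoint add1 neg1 gyr1 scale1 a b)"
proof -
  interpret G: generalized_gyrovector_space add1 e1 neg1 gyr1 scale1 \<phi>1 vadd1 vscale1
    by (fact assms(1))
  interpret H: generalized_gyrovector_space add2 e2 neg2 gyr2 scale2 \<phi>2 vadd2 vscale2
    by (fact assms(2))
  obtain N1 where N1: "gyronormed_gyrogroup add1 e1 neg1 gyr1 N1"
    and eq1: "\<And>a b x y. gyronormed_gyrogroup.gdist add1 neg1 N1 a b
      = gyronormed_gyrogroup.gdist add1 neg1 N1 x y
      \<longleftrightarrow> gyrometric add1 neg1 \<phi>1 a b = gyrometric add1 neg1 \<phi>1 x y"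
    using G.gyrometric_gyronorm by blast
  obtain N2 where N2: "gyronormed_gyrogroup add2 e2 neg2 gyr2 N2"
    and eq2: "\<And>a b x y. gyronormed_gyrogroup.gdist add2 neg2 N2 a b
      = gyronormed_gyrogroup.gdist add2 neg2 N2 x y
      \<longleftrightarrow> gyrometric add2 neg2 \<phi>2 a b = gyrometric add2 neg2 \<phi>2 x y"
    using H.gyrometric_gyronorm by blast
  interpret G: gyronormed_gyrogroup add1 e1 neg1 gyr1 N1
    by (fact N1)
  interpret H: gyronormed_gyrogroup add2 e2 neg2 gyr2 N2
    by (fact N2)
  have T_gdist: "H.gdist (T a) (T b) = H.gdist (T x) (T y) \<longleftrightarrow> G.gdist a b = G.gdist x y"
    for a b x y
    by (simp add: eq1 eq2 assms(4))
  have "inj T"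
  proof (rule injI)
    fix a b
    assume "T a = T b"
    then have "G.gdist a b = G.gdist a a"
      using T_gdist[of a b a a] by simp
    then show "a = b"
      by (metis G.gdist_eq_0)
  qed
  with assms(3) have T: "bij T"
    by (simp add: bij_def)
  have T_inv: "T (inv T y) = y" for y
    by (rule surj_f_inv_f[OF assms(3)])
  have inv_T: "inv T (T x) = x" for x
    by (rule inv_f_f[OF \<open>inj T\<close>])
  show ?thesis
  proof (intro allI)
    fix a b
    define p where "p = gyromidpoint add1 neg1 gyr1 scale1 a b"
    define q where "q = gyromidpoint add2 neg2 gyr2 scale2 (T a) (T b)"
    define g where "g = G.reflect p \<circ> inv T \<circ> H.reflect q \<circ> T"
    have p: "G.reflect p a = b" "G.reflect p b = a"
      unfolding p_def using G.reflect_gyromidpoint G.reflect_reflect by metis+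
    have q: "H.reflect q (T a) = T b" "H.reflect q (T b) = T a"
      unfolding q_def using H.reflect_gyromidpoint H.reflect_reflect by metis+
    have "g p = p"
    proof (rule G.isometry_fixes_centre)
      show "bij g"
        unfolding g_def by (intro bij_comp G.bij_reflect H.bij_reflect bij_imp_bij_inv T)
      \<comment> \<open>The reflection in \<open>q\<close> preserves the distance of
        \<open>T x\<close> and \<open>T y\<close>; \<open>T_gdist\<close> pulls this equality of
        distances back.\<close>
      show "G.gdist (g x) (g y) = G.gdist x y" for x y
        using T_gdist[of "inv T (H.reflect q (T x))" "inv T (H.reflect q (T y))" x y]
        by (simp add: g_def G.gdist_reflect H.gdist_reflect T_inv)
      show "g a = a" "g b = b"
        by (simp_all add: g_def p q inv_T)
    qed (fact p(1))
    then have "inv T (H.reflect q (T p)) = p"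
      by (metis G.reflect_reflect G.reflect_self comp_apply g_def)
    then have "H.reflect q (T p) = T p"
      by (metis T_inv)
    \<comment> \<open>A fixed point of the reflection has twice its distance to \<open>q\<close>
      equal to 0.\<close>
    then have "H.gdist q (T p) = 0"
      by (metis H.gdist_eq_0 H.gdist_reflect_self mult_eq_0_iff zero_neq_numeral)
    then show "gyromidpoint add2 neg2 gyr2 scale2 (T a) (T b)
        = T (gyromidpoint add1 neg1 gyr1 scale1 a b)"
      by (simp add: H.gdist_eq_0 p_def q_def)
  qed
qed

end
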